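(* Every countable virtually free group is demonstrable for R. Thompson's group $V$, i.e. is isomorphic to a demonstrative subgroup of $V$.
   Context: Let $\mathfrak{C}_2 := \{0,1\}^\omega$ be the Cantor space of infinite binary strings with the product topology. A barrier is a finite set $\mathcal{B}\subset\{0,1\}^\ast$ of finite strings such that every element of $\{0,1\}^\omega$ has a unique string in $\mathcal{B}$ as a prefix. Given barriers $\mathcal{D},\mathcal{R}$ and a bijection $\sigma:\mathcal{D}\to\mathcal{R}$, the induced prefix replacement map is the map $\mathfrak{C}_2\to\mathfrak{C}_2$ sending $d\hat{x}\mapsto d^\sigma\hat{x}$ for all $d\in\mathcal{D}$, $\hat{x}\in\{0,1\}^\omega$. R. Thompson's group $V$ is the group of all prefix replacement maps of $\mathfrak{C}_2$ under composition; it acts on $\mathfrak{C}_2$ on the right. A subgroup $H\le V$ is a demonstrative subgroup of $V$ (over $\mathfrak{C}_2$) if there exists a non-empty open subset $U\subset\mathfrak{C}_2$ such that for any two elements $g_1,g_2\in H$ we have $Ug_1\cap Ug_2=\emptyset$ if and only if $g_1\neq g_2$. A group is virtually free if it contains a free group (possibly trivial) as a subgroup of finite index. *)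

theory Defs
  imports
    "HOL-Analysis.Function_Topology"
    "HOL-Library.Omega_Words_Fun"
    "HOL-Algebra.Coset"
begin

section \<open>Thompson's group V\<close>

text \<open>Cantor space is the type \<open>nat \<Rightarrow> bool\<close>. Its type-class topology is the product topology
  over the discrete space \<open>bool\<close>, and \<open>w \<frown> x\<close> is the string \<open>w\<close> followed by \<open>x\<close>.\<close>

type_synonym cantor = "nat \<Rightarrow> bool"

definition is_prefix_of :: "bool list \<Rightarrow> cantor \<Rightarrow> bool" where
  "is_prefix_of w x \<longleftrightarrow> (\<exists>y. x = w \<frown> y)"

definition barrier :: "bool list set \<Rightarrow> bool" where
  "barrier B \<longleftrightarrow> finite B \<and> (\<forall>x. \<exists>!b. b \<in> B \<and> is_prefix_of b x)"

definition prefix_replacement_map :: "(cantor \<Rightarrow> cantor) \<Rightarrow> bool" where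
  "prefix_replacement_map f \<longleftrightarrow>
     (\<exists>D R \<sigma>. barrier D \<and> barrier R \<and> bij_betw \<sigma> D R \<and> (\<forall>d\<in>D. \<forall>x. f (d \<frown> x) = \<sigma> d \<frown> x))"

text \<open>The action is on the right, so the product of \<open>f\<close> and \<open>g\<close> applies \<open>f\<close> first.\<close>

definition thompson_V :: "(cantor \<Rightarrow> cantor) monoid" where
  "thompson_V = \<lparr>carrier = {f. prefix_replacement_map f}, mult = (\<lambda>f g. g \<circ> f), one = id\<rparr>"

definition demonstrative_subgroup :: "(cantor \<Rightarrow> cantor) set \<Rightarrow> bool" where
  "demonstrative_subgroup H \<longleftrightarrow> subgroup H thompson_V \<and>
     (\<exists>U::cantor set. open U \<and> U \<noteq> {} \<and>
        (\<forall>g1\<in>H. \<forall>g2\<in>H. g1 ` U \<inter> g2 ` U = {} \<longleftrightarrow> g1 \<noteq> g2))"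

definition demonstrable_for_V :: "('a, 'b) monoid_scheme \<Rightarrow> bool" where
  "demonstrable_for_V G \<longleftrightarrow> (\<exists>H. demonstrative_subgroup H \<and> G \<cong> thompson_V\<lparr>carrier := H\<rparr>)"

section \<open>Virtually free groups\<close>

text \<open>The free group on \<open>X\<close> consists of the reduced words over \<open>X\<close>; the letter \<open>(x, True)\<close>
  stands for \<open>x\<close> and \<open>(x, False)\<close> for its inverse.\<close>

definition inv_letter :: "'a \<times> bool \<Rightarrow> 'a \<times> bool" where
  "inv_letter l = (fst l, \<not> snd l)"

definition reduced_word :: "('a \<times> bool) list \<Rightarrow> bool" where
  "reduced_word w \<longleftrightarrow> successively (\<lambda>l m. m \<noteq> inv_letter l) w"

fun cons_letter :: "'a \<times> bool \<Rightarrow> ('a \<times> bool) list \<Rightarrow> ('a \<times> bool) list" where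
  "cons_letter l [] = [l]"
| "cons_letter l (m # w) = (if m = inv_letter l then w else l # m # w)"

definition free_group :: "'a set \<Rightarrow> ('a \<times> bool) list monoid" where
  "free_group X = \<lparr>carrier = {w. fst ` set w \<subseteq> X \<and> reduced_word w},
     mult = (\<lambda>u v. foldr cons_letter u v), one = []\<rparr>"

text \<open>A free basis of a group is a subset of it, so nothing is lost by taking \<open>X\<close> in its carrier.\<close>

definition is_free_group :: "('a, 'b) monoid_scheme \<Rightarrow> bool" where
  "is_free_group F \<longleftrightarrow> group F \<and> (\<exists>X \<subseteq> carrier F. F \<cong> free_group X)"

definition virtually_free :: "('a, 'b) monoid_scheme \<Rightarrow> bool" where
  "virtually_free G \<longleftrightarrow> group G \<and>
     (\<exists>F. subgroup F G \<and> finite (rcosets\<^bsub>G\<^esub> F) \<and> is_free_group (G\<lparr>carrier := F\<rparr>))"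

end

theory Submission
  imports Defs
begin

text \<open>The free group acts on Cantor space by ping-pong: the cones \<open>1\<^sup>k0\<close> with \<open>k \<ge> 1\<close> are assigned
  injectively to the letters, a letter \<open>l\<close> maps the complement of the cone of its inverse onto the
  cone of \<open>l\<close>, and the cone \<open>0\<close> is left for the demonstrating open set. The action of a
  subgroup \<open>F\<close> of index \<open>n\<close> is then induced up: with coset representatives \<open>t i\<close> and
  \<open>t i \<otimes> g = f \<otimes> t j\<close>, the element \<open>g\<close> maps the cone of \<open>i\<close> to the cone of \<open>j\<close>, acting
  by \<open>f\<close> on the tails, and it fixes everything outside the \<open>n\<close> cones.\<close>

section \<open>Maps that replace long enough prefixes\<close>

text \<open>One uniform length bound stands in for the domain barrier, so that composition and case
  distinction can be handled without barriers. A bijection of this kind lies in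
  \<open>V\<close>.\<close>

definition replaces_prefixes :: "(cantor \<Rightarrow> cantor) \<Rightarrow> bool" where
  "replaces_prefixes f \<longleftrightarrow> (\<exists>N. \<forall>w. N \<le> length w \<longrightarrow> (\<exists>v. \<forall>x. f (w \<frown> x) = v \<frown> x))"

lemma conc_inject_same_length:
  assumes "u \<frown> x = v \<frown> y" "length u = length v"
  shows "u = v" "x = y"
  using assms by (metis prefix_conc_length, metis assms(2) suffix_conc_length)

text \<open>The words of length \<open>N\<close> form the domain barrier. Their replacements form
  the range barrier: surjectivity of \<open>f\<close> gives each sequence a prefix among them,
  injectivity makes it unique.\<close>

lemma prefix_replacement_mapI:
  assumes "bij f" "replaces_prefixes f"
  shows "prefix_replacement_map f"
proof -
  obtain N where "\<And>w. N \<le> length w \<Longrightarrow> \<exists>v. \<forall>x. f (w \<frown> x) = v \<frown> x"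
    using assms(2) unfolding replaces_prefixes_def by blast
  then obtain \<sigma> where \<sigma>: "\<And>w x. N \<le> length w \<Longrightarrow> f (w \<frown> x) = \<sigma> w \<frown> x"
    by metis
  define D where "D = {w :: bool list. length w = N}"
  have fin: "finite D"
    unfolding D_def using finite_lists_length_eq[of "UNIV :: bool set" N] by simp
  have split: "\<exists>w\<in>D. \<exists>y. x = w \<frown> y" for x
    unfolding D_def by (metis (mono_tags) mem_Collect_eq word_split)
  have inj: "w = w' \<and> y = y'"
    if "w \<in> D" "w' \<in> D" "\<sigma> w \<frown> y = \<sigma> w' \<frown> y'" for w w' y y'
  proof -
    have "f (w \<frown> y) = f (w' \<frown> y')"
      using that \<sigma> by (simp add: D_def)
    then have "w \<frown> y = w' \<frown> y'"
      using assms(1) by (simp add: bij_def inj_eq)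
    then show ?thesis
      using conc_inject_same_length[of w y w' y'] that(1,2) by (simp add: D_def)
  qed
  have "barrier D"
    unfolding barrier_def is_prefix_of_def
  proof (intro conjI allI ex_ex1I)
    show "b = c"
      if "b \<in> D \<and> (\<exists>y. x = b \<frown> y)" "c \<in> D \<and> (\<exists>y. x = c \<frown> y)" for x b c
      using that conc_inject_same_length(1) unfolding D_def by blast
  qed (use fin split in blast)+
  moreover have "barrier (\<sigma> ` D)"
    unfolding barrier_def is_prefix_of_def
  proof (intro conjI allI ex_ex1I)
    fix x
    obtain y where "x = f y"
      using assms(1) by (metis bij_pointE)
    moreover obtain w z where "w \<in> D" "y = w \<frown> z"
      using split by blast
    ultimately show "\<exists>b. b \<in> \<sigma> ` D \<and> (\<exists>y. x = b \<frown> y)"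
      using \<sigma> D_def by auto
  next
    fix x b c
    assume "b \<in> \<sigma> ` D \<and> (\<exists>y. x = b \<frown> y)" "c \<in> \<sigma> ` D \<and> (\<exists>y. x = c \<frown> y)"
    then show "b = c"
      using inj by blast
  qed (use fin in simp)
  moreover have "bij_betw \<sigma> D (\<sigma> ` D)"
    using inj by (metis inj_onI inj_on_imp_bij_betw)
  ultimately show ?thesis
    unfolding prefix_replacement_map_def using \<sigma> D_def by blast
qed

lemma replaces_prefixes_ident: "replaces_prefixes (\<lambda>x. x)"
  unfolding replaces_prefixes_def by auto

lemma replaces_prefixes_conc: "replaces_prefixes (\<lambda>x. u \<frown> x)"
  unfolding replaces_prefixes_def by auto

lemma replaces_prefixes_suffix: "replaces_prefixes (suffix k)"
  unfolding replaces_prefixes_def by (metis suffix_conc_fst)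

lemma replaces_prefixes_comp:
  assumes "replaces_prefixes f" "replaces_prefixes g"
  shows "replaces_prefixes (\<lambda>x. g (f x))"
proof -
  obtain M where M: "\<And>w. M \<le> length w \<Longrightarrow> \<exists>v. \<forall>x. f (w \<frown> x) = v \<frown> x"
    using assms(1) unfolding replaces_prefixes_def by blast
  obtain N where N: "\<And>w. N \<le> length w \<Longrightarrow> \<exists>v. \<forall>x. g (w \<frown> x) = v \<frown> x"
    using assms(2) unfolding replaces_prefixes_def by blast
  have "\<exists>v. \<forall>x. g (f (w \<frown> x)) = v \<frown> x" if len: "M + N \<le> length w" for w
  proof -
    obtain v where v: "\<And>x. f (take M w \<frown> x) = v \<frown> x"
      using M[of "take M w"] len by auto
    \<comment> \<open>\<open>v\<close> may be short, even empty, but the letters of \<open>w\<close>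
      after the first \<open>M\<close> pass through \<open>f\<close> unchanged, and at least
      \<open>N\<close> of them remain for \<open>g\<close>.\<close>
    have "f (w \<frown> x) = (v @ drop M w) \<frown> x" for x
      using v[of "drop M w \<frown> x"] by simp
    moreover have "N \<le> length (v @ drop M w)"
      using len by simp
    ultimately show ?thesis
      using N by presburger
  qed
  then show ?thesis
    unfolding replaces_prefixes_def by blast
qed

text \<open>Once \<open>w\<close> has at least \<open>N\<close> letters, the test is constant on the
  sequences beginning with \<open>w\<close>, so a single branch applies there.\<close>

lemma replaces_prefixes_if:
  assumes "replaces_prefixes f" "replaces_prefixes g"
    and P: "\<And>x y. (\<And>i. i < N \<Longrightarrow> x i = y i) \<Longrightarrow> P x = P y"
  shows "replaces_prefixes (\<lambda>x. if P x then f x else g x)"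
proof -
  obtain K where K: "\<And>w. K \<le> length w \<Longrightarrow> \<exists>v. \<forall>x. f (w \<frown> x) = v \<frown> x"
    using assms(1) unfolding replaces_prefixes_def by blast
  obtain M where M: "\<And>w. M \<le> length w \<Longrightarrow> \<exists>v. \<forall>x. g (w \<frown> x) = v \<frown> x"
    using assms(2) unfolding replaces_prefixes_def by blast
  have "\<exists>v. \<forall>x. (if P (w \<frown> x) then f (w \<frown> x) else g (w \<frown> x)) = v \<frown> x"
    if "K + M + N \<le> length w" for w
  proof -
    have "P (w \<frown> x) = P (w \<frown> y)" for x y
      using that by (intro P) simp
    then consider "\<And>x. P (w \<frown> x)" | "\<And>x. \<not> P (w \<frown> x)"
      by blast
    then show ?thesis
      using K[of w] M[of w] that by cases simp_all
  qed
  then show ?thesis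
    unfolding replaces_prefixes_def by blast
qed

section \<open>Demonstrative actions\<close>

text \<open>A right action. Translates of \<open>U\<close> are compared only with \<open>U\<close>
  itself: in a group, applying an inverse reduces any two translates to this case, and inverses also
  make each \<open>A g\<close> bijective.\<close>

definition demonstrative_action ::
  "('a, 'b) monoid_scheme \<Rightarrow> ('a \<Rightarrow> cantor \<Rightarrow> cantor) \<Rightarrow> cantor set \<Rightarrow> bool" where
  "demonstrative_action G A U \<longleftrightarrow>
     (\<forall>g\<in>carrier G. replaces_prefixes (A g)) \<and>
     A \<one>\<^bsub>G\<^esub> = id \<and>
     (\<forall>g\<in>carrier G. \<forall>h\<in>carrier G. A (g \<otimes>\<^bsub>G\<^esub> h) = A h \<circ> A g) \<and>
     open U \<and> U \<noteq> {} \<and>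
     (\<forall>g\<in>carrier G. g \<noteq> \<one>\<^bsub>G\<^esub> \<longrightarrow> A g ` U \<inter> U = {})"

lemma demonstrable_for_V_if_demonstrative_action:
  fixes G (structure)
  assumes "group G" "demonstrative_action G A U"
  shows "demonstrable_for_V G"
proof -
  interpret group G by fact
  have loc: "\<And>g. g \<in> carrier G \<Longrightarrow> replaces_prefixes (A g)"
    and one: "A \<one> = id"
    and mult: "\<And>g h. g \<in> carrier G \<Longrightarrow> h \<in> carrier G \<Longrightarrow> A (g \<otimes> h) = A h \<circ> A g"
    and U: "open U" "U \<noteq> {}"
    and disj: "\<And>g. g \<in> carrier G \<Longrightarrow> g \<noteq> \<one> \<Longrightarrow> A g ` U \<inter> U = {}"
    using assms(2) unfolding demonstrative_action_def by blast+
  have linv: "A (inv g) (A g x) = x" if "g \<in> carrier G" for g x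
    using mult[of g "inv g"] that one by (simp add: fun_eq_iff)
  have rinv: "A g (A (inv g) x) = x" if "g \<in> carrier G" for g x
    using mult[of "inv g" g] that one by (simp add: fun_eq_iff)
  have V: "A g \<in> carrier thompson_V" if "g \<in> carrier G" for g
  proof -
    have "bij (A g)"
      using linv[OF that] rinv[OF that] by (metis bijI')
    then show ?thesis
      using prefix_replacement_mapI loc that by (simp add: thompson_V_def)
  qed
  \<comment> \<open>The inverse in \<open>thompson_V\<close> is a definite description:
    \<open>A (inv g)\<close> is a two-sided inverse, and it is the only one because
    \<open>A g\<close> is onto.\<close>
  have inv_V: "inv\<^bsub>thompson_V\<^esub> (A g) = A (inv g)" if "g \<in> carrier G" for g
    unfolding m_inv_def[of thompson_V]
  proof (rule the_equality)
    show "A (inv g) \<in> carrier thompson_V \<and>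
        A g \<otimes>\<^bsub>thompson_V\<^esub> A (inv g) = \<one>\<^bsub>thompson_V\<^esub> \<and>
        A (inv g) \<otimes>\<^bsub>thompson_V\<^esub> A g = \<one>\<^bsub>thompson_V\<^esub>"
      using V that linv rinv by (auto simp: thompson_V_def)
  next
    fix y
    assume "y \<in> carrier thompson_V \<and> A g \<otimes>\<^bsub>thompson_V\<^esub> y = \<one>\<^bsub>thompson_V\<^esub> \<and>
        y \<otimes>\<^bsub>thompson_V\<^esub> A g = \<one>\<^bsub>thompson_V\<^esub>"
    then have "y (A g x) = x" for x
      by (simp add: thompson_V_def fun_eq_iff)
    then show "y = A (inv g)"
      using rinv[OF that] by (metis ext)
  qed
  define H where "H = A ` carrier G"
  have sub: "subgroup H thompson_V"
  proof
    show "H \<subseteq> carrier thompson_V"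
      using V by (auto simp: H_def)
    show "x \<otimes>\<^bsub>thompson_V\<^esub> y \<in> H" if xy: "x \<in> H" "y \<in> H" for x y
    proof -
      obtain g h where gh: "g \<in> carrier G" "h \<in> carrier G" "x = A g" "y = A h"
        using xy by (auto simp: H_def)
      then have "x \<otimes>\<^bsub>thompson_V\<^esub> y = A (g \<otimes> h)"
        by (simp add: mult thompson_V_def)
      then show ?thesis
        unfolding H_def using gh by blast
    qed
    have "\<one>\<^bsub>thompson_V\<^esub> = A \<one>"
      using one by (simp add: thompson_V_def)
    then show "\<one>\<^bsub>thompson_V\<^esub> \<in> H"
      unfolding H_def by blast
    show "inv\<^bsub>thompson_V\<^esub> x \<in> H" if "x \<in> H" for x
      using that inv_V inv_closed unfolding H_def by auto
  qed
  \<comment> \<open>Applying \<open>A (inv h)\<close> to a common point of the two translates shows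
    that \<open>g \<otimes> inv h\<close> sends a point of \<open>U\<close> into \<open>U\<close>.
    As \<open>U\<close> is non-empty, this also yields injectivity of \<open>A\<close>.\<close>
  have meet: "g = h" if gh: "g \<in> carrier G" "h \<in> carrier G" "A g ` U \<inter> A h ` U \<noteq> {}" for g h
  proof -
    obtain x y where "x \<in> U" "y \<in> U" "A g x = A h y"
      using gh(3) by auto
    then have "A (g \<otimes> inv h) x = y"
      using mult linv gh by (simp add: comp_def)
    then have "g \<otimes> inv h = \<one>"
      using disj[of "g \<otimes> inv h"] \<open>x \<in> U\<close> \<open>y \<in> U\<close> gh by blast
    then show ?thesis
      using gh inv_solve_right'[of \<one> g h] by simp
  qed
  have "inj_on A (carrier G)"
    using meet U(2) by (intro inj_onI) simp
  moreover have "A \<in> hom G (thompson_V\<lparr>carrier := H\<rparr>)"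
    using mult by (auto simp: hom_def H_def thompson_V_def)
  ultimately have "G \<cong> thompson_V\<lparr>carrier := H\<rparr>"
    unfolding is_iso_def iso_def bij_betw_def by (auto simp: H_def)
  moreover have "demonstrative_subgroup H"
    unfolding demonstrative_subgroup_def
  proof (intro conjI exI[of _ U] ballI sub U)
    fix x y
    assume "x \<in> H" "y \<in> H"
    then obtain g h where "g \<in> carrier G" "h \<in> carrier G" "x = A g" "y = A h"
      by (auto simp: H_def)
    then show "x ` U \<inter> y ` U = {} \<longleftrightarrow> x \<noteq> y"
      using meet U(2) by auto
  qed
  ultimately show ?thesis
    unfolding demonstrable_for_V_def by blast
qed

text \<open>The preimage \<open>e\<close> of the identity of \<open>K\<close> is idempotent in the
  group \<open>F\<close>, hence is the identity of \<open>F\<close>. So nontrivial elements of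
  \<open>F\<close> go to nontrivial elements of \<open>K\<close>, as disjointness requires.\<close>

lemma demonstrative_action_iso:
  assumes "group F" "\<phi> \<in> iso F K" "\<one>\<^bsub>K\<^esub> \<in> carrier K" "\<one>\<^bsub>K\<^esub> \<otimes>\<^bsub>K\<^esub> \<one>\<^bsub>K\<^esub> = \<one>\<^bsub>K\<^esub>"
    and act: "demonstrative_action K A U"
  shows "demonstrative_action F (\<lambda>f. A (\<phi> f)) U"
proof -
  interpret F: group F by fact
  have mult: "\<And>f g. f \<in> carrier F \<Longrightarrow> g \<in> carrier F \<Longrightarrow> \<phi> (f \<otimes>\<^bsub>F\<^esub> g) = \<phi> f \<otimes>\<^bsub>K\<^esub> \<phi> g"
    and carr: "\<And>f. f \<in> carrier F \<Longrightarrow> \<phi> f \<in> carrier K"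
    and bij: "bij_betw \<phi> (carrier F) (carrier K)"
    using assms(2) by (auto simp: iso_def hom_def)
  obtain e where e: "e \<in> carrier F" "\<phi> e = \<one>\<^bsub>K\<^esub>"
    using bij assms(3) by (metis bij_betw_imp_surj_on imageE)
  then have "\<phi> (e \<otimes>\<^bsub>F\<^esub> e) = \<phi> e"
    using mult assms(4) by simp
  then have "e \<otimes>\<^bsub>F\<^esub> e = e"
    using bij e(1) by (metis F.m_closed bij_betw_imp_inj_on inj_onD)
  then have one: "\<phi> \<one>\<^bsub>F\<^esub> = \<one>\<^bsub>K\<^esub>"
    using e by simp
  then have "\<phi> f \<noteq> \<one>\<^bsub>K\<^esub>" if "f \<in> carrier F" "f \<noteq> \<one>\<^bsub>F\<^esub>" for f
    using that bij by (metis F.one_closed bij_betw_imp_inj_on inj_onD)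
  then show ?thesis
    using act one mult carr unfolding demonstrative_action_def by simp
qed

section \<open>Cones\<close>

text \<open>These cones are pairwise disjoint and infinite in number, so every letter of a countable
  alphabet can have its own.\<close>

definition cone :: "nat \<Rightarrow> cantor \<Rightarrow> cantor" where
  "cone i x = (replicate i True @ [False]) \<frown> x"

lemma suffix_cone [simp]: "suffix (Suc i) (cone i x) = x"
  unfolding cone_def using suffix_conc_length[of "replicate i True @ [False]" x] by simp

lemma cone_nth: "cone i x j \<longleftrightarrow> (if j \<le> i then j < i else x (j - Suc i))"
  by (auto simp: cone_def conc_def nth_append)

lemma cone_eq_iff [simp]: "cone i x = cone j y \<longleftrightarrow> i = j \<and> x = y"
proof
  assume eq: "cone i x = cone j y"
  have "i = j"
  proof (rule ccontr)
    assume "i \<noteq> j"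
    then show False
      \<comment> \<open>At position \<open>min i j\<close> one sequence has its first 0 while the
        other still has a 1.\<close>
      using fun_cong[OF eq, of "min i j"] by (auto simp: cone_nth min_def split: if_splits)
  qed
  then show "i = j \<and> x = y"
    using eq by (metis suffix_cone)
qed simp

text \<open>Membership is decided by the first \<open>i + 1\<close> digits, which is why branching
  on it preserves \<open>replaces_prefixes\<close>.\<close>

lemma range_cone_iff: "x \<in> range (cone i) \<longleftrightarrow> (\<forall>j<i. x j) \<and> \<not> x i"
proof
  assume x: "(\<forall>j<i. x j) \<and> \<not> x i"
  have "x j = cone i (suffix (Suc i) x) j" for j
  proof -
    consider "j < i" | "j = i" | d where "j = Suc (i + d)"
      by (metis less_imp_Suc_add linorder_neqE_nat)
    then show ?thesis
      by cases (use x in \<open>simp_all add: cone_nth\<close>)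
  qed
  then have "x = cone i (suffix (Suc i) x)"
    by blast
  then show "x \<in> range (cone i)"
    by blast
qed (auto simp: cone_nth)

lemma cone_suffix: "x \<in> range (cone i) \<Longrightarrow> cone i (suffix (Suc i) x) = x"
  by auto

lemma replaces_prefixes_cone: "replaces_prefixes (cone i)"
  unfolding cone_def by (rule replaces_prefixes_conc)

lemma replaces_prefixes_if_cone:
  assumes "replaces_prefixes f" "replaces_prefixes g"
  shows "replaces_prefixes (\<lambda>x. if x \<in> range (cone i) then f x else g x)"
  using assms by (rule replaces_prefixes_if[where N = "Suc i"]) (simp add: range_cone_iff)

lemma open_cone_image:
  assumes "open U"
  shows "open (cone 0 ` U)"
proof -
  \<comment> \<open>The shift undoes prefixing by 0, so the image is the shift preimage of
    \<open>U\<close> cut down to the clopen set of sequences starting with 0.\<close>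
  have "cone 0 ` U = (\<lambda>x. x 0) -` {False} \<inter> suffix 1 -` U"
  proof (intro equalityI subsetI)
    fix x
    assume x: "x \<in> (\<lambda>x. x 0) -` {False} \<inter> suffix 1 -` U"
    then have "x = cone 0 (suffix 1 x)"
      using cone_suffix[of x 0] by (simp add: range_cone_iff)
    then show "x \<in> cone 0 ` U"
      using x by blast
  qed (auto simp: cone_nth simp flip: One_nat_def, simp add: suffix_cone[simplified])
  moreover have "continuous_on UNIV (suffix 1 :: cantor \<Rightarrow> cantor)"
    unfolding suffix_def
    by (intro continuous_on_coordinatewise_then_product continuous_on_product_coordinates)
  moreover have "continuous_on UNIV (\<lambda>x :: cantor. x 0)"
    by (rule continuous_on_product_coordinates)
  ultimately show ?thesis
    using assms by (metis open_Int open_vimage open_discrete)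
qed

section \<open>Ping-pong action of the free group\<close>

text \<open>\<open>drop_cone m\<close> identifies the complement of the \<open>m\<close>-th cone with the whole space, and
  \<open>skip_cone m\<close> is its inverse.\<close>

definition skip_cone :: "nat \<Rightarrow> cantor \<Rightarrow> cantor" where
  "skip_cone m x = (if \<forall>i<m. x i then [True] \<frown> x else x)"

definition drop_cone :: "nat \<Rightarrow> cantor \<Rightarrow> cantor" where
  "drop_cone m x = (if \<forall>i<Suc m. x i then suffix 1 x else x)"

text \<open>A bijection carrying cone \<open>m\<close> onto the complement of cone \<open>k\<close>,
  and the complement of cone \<open>m\<close> onto cone \<open>k\<close>. For a letter,
  \<open>k\<close> belongs to the letter and \<open>m\<close> to its inverse.\<close>

definition ping_pong :: "nat \<Rightarrow> nat \<Rightarrow> cantor \<Rightarrow> cantor" where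
  "ping_pong m k x =
     (if x \<in> range (cone m) then skip_cone k (suffix (Suc m) x) else cone k (drop_cone m x))"

text \<open>The sequences outside cone \<open>m\<close> are those with a 0 among the first
  \<open>m\<close> digits and those beginning with \<open>m + 1\<close> ones. The former are left
  fixed; the latter arise by lengthening an initial run of \<open>m\<close> ones.\<close>

lemma skip_cone_notin_range: "skip_cone m x \<notin> range (cone m)"
  by (cases m) (auto simp: skip_cone_def range_cone_iff conc_def)

lemma drop_skip_cone: "drop_cone m (skip_cone m x) = x"
proof (cases "\<forall>i<m. x i")
  case True
  then have "\<forall>i<Suc m. ([True] \<frown> x) i"
    by (auto simp: conc_def)
  then show ?thesis
    using True suffix_conc_length[of "[True]" x] by (simp add: skip_cone_def drop_cone_def)
qed (auto simp: skip_cone_def drop_cone_def)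

lemma skip_drop_cone:
  assumes "x \<notin> range (cone m)"
  shows "skip_cone m (drop_cone m x) = x"
proof (cases "\<forall>i<Suc m. x i")
  case True
  then have "[True] \<frown> suffix 1 x = x"
    by (auto simp: fun_eq_iff conc_def)
  then show ?thesis
    using True by (simp add: skip_cone_def drop_cone_def)
next
  case False
  then show ?thesis
    using assms by (auto simp: skip_cone_def drop_cone_def range_cone_iff less_Suc_eq)
qed

text \<open>Cone \<open>m\<close> is sent off cone \<open>k\<close> and its complement into cone
  \<open>k\<close>, so with the indices exchanged the opposite branch applies and undoes the first.
  Exchanging the indices is passing from a letter to its inverse.\<close>

lemma ping_pong_inverse: "ping_pong k m (ping_pong m k x) = x"
proof (cases "x \<in> range (cone m)")
  case True
  then show ?thesis
    by (simp add: ping_pong_def skip_cone_notin_range drop_skip_cone cone_suffix)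
next
  case False
  then show ?thesis
    by (simp add: ping_pong_def skip_drop_cone)
qed

lemma replaces_prefixes_ping_pong: "replaces_prefixes (ping_pong m k)"
proof -
  have "replaces_prefixes (skip_cone k)"
    unfolding skip_cone_def
    by (rule replaces_prefixes_if[where N = k, OF replaces_prefixes_conc replaces_prefixes_ident])
      auto
  moreover have "replaces_prefixes (drop_cone m)"
    unfolding drop_cone_def
    by (rule replaces_prefixes_if[where N = "Suc m", OF replaces_prefixes_suffix
          replaces_prefixes_ident]) auto
  ultimately have "replaces_prefixes (\<lambda>x. skip_cone k (suffix (Suc m) x))"
    and "replaces_prefixes (\<lambda>x. cone k (drop_cone m x))"
    using replaces_prefixes_comp replaces_prefixes_suffix replaces_prefixes_cone by blast+
  then show ?thesis
    unfolding ping_pong_def by (rule replaces_prefixes_if_cone)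
qed

section \<open>Actions of words, first letter first\<close>

primrec word_action :: "('l \<Rightarrow> cantor \<Rightarrow> cantor) \<Rightarrow> 'l list \<Rightarrow> cantor \<Rightarrow> cantor" where
  "word_action a [] = id"
| "word_action a (l # w) = word_action a w \<circ> a l"

lemma replaces_prefixes_word_action:
  assumes "\<And>l. replaces_prefixes (a l)"
  shows "replaces_prefixes (word_action a w)"
proof (induction w)
  case (Cons l w)
  then show ?case
    using replaces_prefixes_comp[OF assms Cons.IH] by (simp add: comp_def)
qed (simp add: id_def replaces_prefixes_ident)

text \<open>\<open>cons_letter\<close> differs from plain consing only where \<open>l\<close> meets
  its inverse, and there the two maps cancel as well. The induction on \<open>u\<close> therefore
  works for all words, reduced or not.\<close>

lemma word_action_foldr_cons_letter:
  assumes "\<And>l x. a (inv_letter l) (a l x) = x"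
  shows "word_action a (foldr cons_letter u v) = word_action a v \<circ> word_action a u"
proof -
  have cons: "word_action a (cons_letter l w) = word_action a w \<circ> a l" for l w
    by (cases w) (auto simp: fun_eq_iff assms)
  show ?thesis
    by (induction u) (simp_all add: cons comp_assoc)
qed

lemma inv_letter_inv_letter [simp]: "inv_letter (inv_letter l) = l"
  by (simp add: inv_letter_def)

lemma fst_inv_letter [simp]: "fst (inv_letter l) = fst l"
  by (simp add: inv_letter_def)

text \<open>The first letter sends \<open>x\<close> into its own cone. In a reduced word the next
  letter is not its inverse, so the new point lies outside the cone of the inverse of the next
  letter and the induction continues.\<close>

lemma word_action_ping_pong:
  assumes "reduced_word w" "w \<noteq> []" "set w \<subseteq> L" "inv_letter ` L \<subseteq> L" "inj_on c L"
    and "x \<notin> range (cone (c (inv_letter (hd w))))"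
  shows "word_action (\<lambda>l. ping_pong (c (inv_letter l)) (c l)) w x \<in> range (cone (c (last w)))"
  using assms
proof (induction w arbitrary: x)
  case (Cons l w)
  have *: "ping_pong (c (inv_letter l)) (c l) x \<in> range (cone (c l))"
    using Cons.prems(6) by (simp add: ping_pong_def)
  show ?case
  proof (cases "w = []")
    case True
    then show ?thesis
      using * by simp
  next
    case False
    then have "hd w \<noteq> inv_letter l" "reduced_word w"
      using Cons.prems(1) by (auto simp: reduced_word_def successively_Cons)
    then have "inv_letter (hd w) \<noteq> l"
      by (metis inv_letter_inv_letter)
    \<comment> \<open>Closure of \<open>L\<close> under inversion puts both letters where
      \<open>c\<close> is injective.\<close>
    moreover have "l \<in> L" "inv_letter (hd w) \<in> L"
      using Cons.prems(3,4) False by (auto intro: hd_in_set)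
    ultimately have "c (inv_letter (hd w)) \<noteq> c l"
      using Cons.prems(5) by (meson inj_onD)
    then have "ping_pong (c (inv_letter l)) (c l) x \<notin> range (cone (c (inv_letter (hd w))))"
      using * by auto
    then show ?thesis
      using Cons.IH[OF \<open>reduced_word w\<close> False] Cons.prems(3-5) False by simp
  qed
qed simp

lemma demonstrative_action_free_group:
  assumes "countable X"
  obtains A U where "demonstrative_action (free_group X) A U"
proof -
  \<comment> \<open>\<open>Suc\<close> keeps cone 0 free of letters; the boolean separates a letter
    from its inverse.\<close>
  define c where
    "c = (\<lambda>l :: 'a \<times> bool. Suc (prod_encode (to_nat_on X (fst l), of_bool (snd l))))"
  define L where "L = X \<times> (UNIV :: bool set)"
  have inj: "inj_on c L"
  proof (rule inj_onI)
    fix l m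
    assume lm: "l \<in> L" "m \<in> L" and eq: "c l = c m"
    have "to_nat_on X (fst l) = to_nat_on X (fst m) \<and> snd l = snd m"
      using eq by (auto simp: c_def prod_encode_eq of_bool_def split: if_splits)
    moreover have "fst l \<in> X" "fst m \<in> X"
      using lm by (auto simp: L_def)
    ultimately show "l = m"
      using inj_on_to_nat_on[OF assms] by (auto simp: prod_eq_iff inj_on_eq_iff)
  qed
  define a where "a = (\<lambda>l. ping_pong (c (inv_letter l)) (c l))"
  \<comment> \<open>Cone 0 is disjoint from all letter cones, so ping-pong can start there whatever
    the first letter is, and it ends in the cone of the last letter.\<close>
  have "word_action a w ` range (cone 0) \<inter> range (cone 0) = {}"
    if "w \<in> carrier (free_group X)" "w \<noteq> \<one>\<^bsub>free_group X\<^esub>" for w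
  proof -
    have w: "reduced_word w" "w \<noteq> []" "set w \<subseteq> L"
      using that by (auto simp: free_group_def L_def)
    have "inv_letter ` L \<subseteq> L"
      by (auto simp: L_def inv_letter_def)
    note ping_pong = word_action_ping_pong[OF w this inj, folded a_def]
    have disj: "cone 0 x \<notin> range (cone (c l))" for x l
      by (auto simp: c_def)
    have "word_action a w (cone 0 x) \<notin> range (cone 0)" for x
      using ping_pong[OF disj[of x]] by (auto simp: c_def)
    then show ?thesis
      by blast
  qed
  moreover have "replaces_prefixes (word_action a w)" for w
    unfolding a_def by (intro replaces_prefixes_word_action replaces_prefixes_ping_pong)
  moreover have "word_action a (foldr cons_letter u v) = word_action a v \<circ> word_action a u" for u v
    by (rule word_action_foldr_cons_letter) (simp add: a_def ping_pong_inverse)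
  moreover have "open (range (cone 0))"
    using open_cone_image by blast
  ultimately have "demonstrative_action (free_group X) (word_action a) (range (cone 0))"
    unfolding demonstrative_action_def by (simp add: free_group_def)
  then show ?thesis
    using that by blast
qed

section \<open>Induced actions\<close>

text \<open>The recursion presents the map as a chain of \<open>n\<close> two-way branches, each of
  which preserves \<open>replaces_prefixes\<close>. Disjointness of the cones makes the order of the
  tests immaterial.\<close>

primrec on_cones :: "nat \<Rightarrow> (nat \<Rightarrow> nat) \<Rightarrow> (nat \<Rightarrow> cantor \<Rightarrow> cantor) \<Rightarrow> cantor \<Rightarrow> cantor" where
  "on_cones 0 p \<phi> x = x"
| "on_cones (Suc n) p \<phi> x =
     (if x \<in> range (cone n) then cone (p n) (\<phi> n (suffix (Suc n) x)) else on_cones n p \<phi> x)"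

lemma on_cones_cone: "i < n \<Longrightarrow> on_cones n p \<phi> (cone i x) = cone (p i) (\<phi> i x)"
  by (induction n) (auto simp: less_Suc_eq)

lemma on_cones_outside: "(\<And>i. i < n \<Longrightarrow> x \<notin> range (cone i)) \<Longrightarrow> on_cones n p \<phi> x = x"
  by (induction n) auto

lemma replaces_prefixes_on_cones:
  "(\<And>i. i < n \<Longrightarrow> replaces_prefixes (\<phi> i)) \<Longrightarrow> replaces_prefixes (on_cones n p \<phi>)"
proof (induction n)
  case 0
  then show ?case
    using replaces_prefixes_ident by simp
next
  case (Suc n)
  have "replaces_prefixes (\<lambda>x. cone (p n) (\<phi> n (suffix (Suc n) x)))"
    by (rule replaces_prefixes_comp[OF _ replaces_prefixes_cone]
        replaces_prefixes_comp[OF replaces_prefixes_suffix])+ (simp add: Suc.prems)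
  then show ?case
    using Suc by (simp add: replaces_prefixes_if_cone)
qed

lemma on_cones_eqI:
  assumes "\<And>i x. i < n \<Longrightarrow> on_cones n p \<phi> (cone i x) = f (cone i x)"
    and "\<And>x. (\<And>i. i < n \<Longrightarrow> x \<notin> range (cone i)) \<Longrightarrow> f x = x"
  shows "on_cones n p \<phi> = f"
proof
  fix x
  show "on_cones n p \<phi> x = f x"
  proof (cases "\<exists>i<n. x \<in> range (cone i)")
    case True
    then show ?thesis
      using assms(1) by blast
  next
    case False
    then show ?thesis
      using assms(2)[of x] by (simp add: on_cones_outside)
  qed
qed

lemma demonstrative_action_finite_index:
  fixes G (structure)
  assumes "group G" "subgroup F G" "finite (rcosets F)"
    and act: "demonstrative_action (G\<lparr>carrier := F\<rparr>) A U"
  obtains B W where "demonstrative_action G B W"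
proof -
  interpret group G by fact
  interpret F: subgroup F G by fact
  have loc: "\<And>f. f \<in> F \<Longrightarrow> replaces_prefixes (A f)"
    and one: "A \<one> = id"
    and mult: "\<And>f h. f \<in> F \<Longrightarrow> h \<in> F \<Longrightarrow> A (f \<otimes> h) = A h \<circ> A f"
    and U: "open U" "U \<noteq> {}"
    and disj: "\<And>f. f \<in> F \<Longrightarrow> f \<noteq> \<one> \<Longrightarrow> A f ` U \<inter> U = {}"
    using act unfolding demonstrative_action_def by auto
  define n where "n = card (rcosets F)"
  obtain e where e: "bij_betw e (rcosets F) {0..<n}"
    unfolding n_def using ex_bij_betw_finite_nat[OF assms(3)] by blast
  \<comment> \<open>The right cosets are numbered in arbitrary order, so coset 0 need not be
    \<open>F\<close> itself.\<close>
  define idx where "idx = (\<lambda>g. e (F #> g))"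
  have idx_less: "idx g < n" if "g \<in> carrier G" for g
    using bij_betwE[OF e] rcosetsI[OF F.subset that] by (auto simp: idx_def)
  have idx_eq: "idx g = idx h \<longleftrightarrow> F #> g = F #> h" if "g \<in> carrier G" "h \<in> carrier G" for g h
    using inj_on_eq_iff[OF bij_betw_imp_inj_on[OF e]] rcosetsI[OF F.subset] that
    by (simp add: idx_def)
  have "\<exists>g\<in>carrier G. idx g = i" if "i < n" for i
  proof -
    have "i \<in> e ` (rcosets F)"
      using e that by (simp add: bij_betw_def)
    then show ?thesis
      by (auto simp: RCOSETS_def idx_def)
  qed
  then obtain t where t: "\<And>i. i < n \<Longrightarrow> t i \<in> carrier G" and idx_t: "\<And>i. i < n \<Longrightarrow> idx (t i) = i"
    by metis
  \<comment> \<open>\<open>p g\<close> is the permutation of coset numbers induced by right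
    multiplication with \<open>g\<close>; \<open>f g i\<close> is the element of \<open>F\<close>
    left over on the chosen representatives.\<close>
  define p where "p = (\<lambda>g i. idx (t i \<otimes> g))"
  define f where "f = (\<lambda>g i. t i \<otimes> g \<otimes> inv (t (p g i)))"
  have p_less: "p g i < n" if "g \<in> carrier G" "i < n" for g i
    using that t idx_less by (simp add: p_def)
  have coset_p: "F #> t (p g i) = F #> (t i \<otimes> g)" if "g \<in> carrier G" "i < n" for g i
    using that t idx_t[OF p_less] p_less idx_eq[of "t (p g i)" "t i \<otimes> g"] by (simp add: p_def)
  have f_in: "f g i \<in> F" if "g \<in> carrier G" "i < n" for g i
  proof -
    have "t i \<otimes> g \<in> F #> t (p g i)"
      using that t by (simp add: coset_p rcos_self F.subgroup_axioms)
    then show ?thesis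
      unfolding f_def using that t p_less F.rcos_module_imp[OF is_group] by simp
  qed
  have p_mult: "p (g \<otimes> h) i = p h (p g i)"
    if "g \<in> carrier G" "h \<in> carrier G" "i < n" for g h i
  proof -
    have "F #> (t i \<otimes> (g \<otimes> h)) = F #> (t i \<otimes> g) #> h"
      using that t by (simp add: coset_mult_assoc F.subset m_assoc)
    also have "\<dots> = F #> (t (p g i) \<otimes> h)"
      using that t p_less by (simp add: coset_mult_assoc F.subset flip: coset_p)
    finally show ?thesis
      by (simp add: p_def idx_def)
  qed
  \<comment> \<open>The cocycle identity, by inserting
    \<open>inv (t (p g i)) \<otimes> t (p g i)\<close> between \<open>g\<close> and
    \<open>h\<close>. With \<open>p_mult\<close> it makes \<open>B\<close> multiplicative.\<close>
  have f_mult: "f (g \<otimes> h) i = f g i \<otimes> f h (p g i)"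
    if "g \<in> carrier G" "h \<in> carrier G" "i < n" for g h i
  proof -
    have "inv (t (p g i)) \<otimes> (t (p g i) \<otimes> h) = h"
      using that t p_less by (simp flip: m_assoc)
    then show ?thesis
      using that t p_less by (simp add: f_def p_mult m_assoc inv_solve_left)
  qed
  define B where "B = (\<lambda>g. on_cones n (p g) (\<lambda>i. A (f g i)))"
  have B_cone: "B g (cone i x) = cone (p g i) (A (f g i) x)" if "i < n" for g i x
    using that by (simp add: B_def on_cones_cone)
  have n_pos: "0 < n"
    using idx_less[OF one_closed] by simp
  have "B \<one> = id"
    unfolding B_def
    by (rule on_cones_eqI) (simp_all add: on_cones_cone p_def f_def t idx_t one)
  moreover have "B (g \<otimes> h) = B h \<circ> B g" if "g \<in> carrier G" "h \<in> carrier G" for g h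
  proof -
    have "B (g \<otimes> h) (cone i x) = (B h \<circ> B g) (cone i x)" if "i < n" for i x
      using \<open>g \<in> carrier G\<close> \<open>h \<in> carrier G\<close> that
      by (simp add: B_cone p_less p_mult f_mult mult f_in)
    then show ?thesis
      unfolding B_def by (intro on_cones_eqI) (simp_all add: on_cones_outside)
  qed
  moreover have "replaces_prefixes (B g)" if "g \<in> carrier G" for g
    unfolding B_def using that by (intro replaces_prefixes_on_cones loc f_in)
  \<comment> \<open>A common point forces \<open>p g 0 = 0\<close> by disjointness of the cones, and
    its tail forces \<open>f g 0 = \<one>\<close> by the choice of \<open>U\<close>. Then
    \<open>t 0 \<otimes> g = t 0\<close>.\<close>
  moreover have "B g ` cone 0 ` U \<inter> cone 0 ` U = {}" if g: "g \<in> carrier G" "g \<noteq> \<one>" for g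
  proof (rule ccontr)
    assume "B g ` cone 0 ` U \<inter> cone 0 ` U \<noteq> {}"
    then obtain x y where xy: "x \<in> U" "y \<in> U" and "B g (cone 0 x) = cone 0 y"
      by blast
    then have p0: "p g 0 = 0" and "A (f g 0) x = y"
      by (simp_all add: B_cone n_pos)
    then have "f g 0 = \<one>"
      using disj[OF f_in[OF g(1) n_pos]] xy by blast
    then have "t 0 \<otimes> g = t 0"
      using g t[OF n_pos] p0 inv_solve_right[of \<one> "t 0 \<otimes> g" "t 0"] by (simp add: f_def)
    then show False
      using g t[OF n_pos] by simp
  qed
  ultimately have "demonstrative_action G B (cone 0 ` U)"
    unfolding demonstrative_action_def using U open_cone_image by blast
  then show ?thesis
    using that by blast
qed

theorem mainTheorem4:
  fixes G :: "('a, 'b) monoid_scheme"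
  assumes "group G"
    and "countable (carrier G)"
    and "virtually_free G"
  shows "demonstrable_for_V G"
proof -
  obtain F where F: "subgroup F G" "finite (rcosets\<^bsub>G\<^esub> F)" "is_free_group (G\<lparr>carrier := F\<rparr>)"
    using assms(3) unfolding virtually_free_def by blast
  let ?F = "G\<lparr>carrier := F\<rparr>"
  obtain X where grp: "group ?F" and X: "X \<subseteq> F" and "?F \<cong> free_group X"
    using F(3) unfolding is_free_group_def by auto
  then obtain \<phi> where \<phi>: "\<phi> \<in> iso ?F (free_group X)"
    unfolding is_iso_def by blast
  \<comment> \<open>The alphabet lies in the carrier, so it inherits countability from
    \<open>G\<close>.\<close>
  have "countable X"
    using assms(2) X subgroup.subset[OF F(1)] by (meson countable_subset subset_trans)
  then obtain A U where "demonstrative_action (free_group X) A U"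
    using demonstrative_action_free_group by blast
  moreover have "\<one>\<^bsub>free_group X\<^esub> \<in> carrier (free_group X)"
    by (simp add: free_group_def reduced_word_def)
  moreover have "\<one>\<^bsub>free_group X\<^esub> \<otimes>\<^bsub>free_group X\<^esub> \<one>\<^bsub>free_group X\<^esub> = \<one>\<^bsub>free_group X\<^esub>"
    by (simp add: free_group_def)
  ultimately have "demonstrative_action ?F (\<lambda>f. A (\<phi> f)) U"
    using demonstrative_action_iso[OF grp \<phi>] by blast
  then obtain B W where "demonstrative_action G B W"
    using demonstrative_action_finite_index[OF assms(1) F(1,2)] by blast
  then show ?thesis
    using demonstrable_for_V_if_demonstrative_action assms(1) by blast
qed

end
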